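(* For every formula $\phi$, the formula $\neg\neg\phi\leftrightarrow\phi$ is a theorem of the propositional proof system IRL defined in the context.
   Context: Language: formulas are built from a countable set $K$ of primitive propositions using the connectives $\top,\bot$ (nullary), $\neg$ (unary), $\wedge,\vee,\leftrightarrow,\to$ (binary, all syntactically independent symbols). $\neg$ binds strongest, and $\wedge,\vee$ bind more strongly than $\to,\leftrightarrow$. Schematic letters $\phi,\psi,\chi$ range over all formulas. Axiom schemas of IRL: $\phi\leftrightarrow\phi$; $\phi\wedge\psi\leftrightarrow\psi\wedge\phi$; $\phi\vee\psi\leftrightarrow\psi\vee\phi$; $(\phi\wedge\psi)\wedge\chi\leftrightarrow\phi\wedge(\psi\wedge\chi)$; $(\phi\vee\psi)\vee\chi\leftrightarrow\phi\vee(\psi\vee\chi)$; $\phi\wedge(\psi\vee\chi)\leftrightarrow(\phi\wedge\psi)\vee(\phi\wedge\chi)$; $\phi\vee(\psi\wedge\chi)\leftrightarrow(\phi\vee\psi)\wedge(\phi\vee\chi)$; $\phi\wedge\top\leftrightarrow\phi$; $\phi\vee\bot\leftrightarrow\phi$; $\phi\wedge\neg\phi\leftrightarrow\bot$; $\phi\vee\neg\phi\leftrightarrow\top$; $(\phi\to\psi)\leftrightarrow(\phi\wedge\psi\leftrightarrow\phi)$. Primitive rules of IRL: (R1) from $\phi,\psi$ infer $\phi\wedge\psi$; (R2) from $\phi\wedge\psi$ infer $\phi$; (R3) from $\phi\leftrightarrow\psi$ and $\chi$ infer $\chi[\phi\mapsto\psi]$, where $\chi[\phi\mapsto\psi]$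 is any formula obtained from $\chi$ by replacing one or more arbitrarily selected occurrences of the subformula $\phi$ by $\psi$; (R4, conditional proof) if $\{\phi\}\vdash\psi$ then $\vdash\phi\to\psi$. Derivations: for a finite set $X$ of formulas, $X\vdash y$ means there is a finite sequence of formulas ending in $y$, each member of which is a theorem or results from members of $X$ and earlier members of the sequence by R1, R2 or R3. A theorem is a formula $y$ with $\emptyset\vdash y$ (written $\vdash y$); axioms are theorems, and formulas $\phi\to\psi$ obtained by R4 are theorems. R4 applies only to derivations with the single premise $\phi$ and no other undischarged premises. *)

theory Defs
  imports Main "HOL-Library.Countable"
begin

datatype 'k fm =
    Prop 'k
  | Top  ("\<^bold>\<top>")
  | Bot  ("\<^bold>\<bottom>")
  | Neg "'k fm"  ("\<^bold>\<not> _" [90] 90)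
  | Conj "'k fm" "'k fm"  (infixl "\<^bold>\<and>" 80)
  | Disj "'k fm" "'k fm"  (infixl "\<^bold>\<or>" 80)
  | Imp "'k fm" "'k fm"  (infix "\<^bold>\<rightarrow>" 70)
  | Iff "'k fm" "'k fm"  (infix "\<^bold>\<leftrightarrow>" 70)

inductive irl_axiom :: "'k fm \<Rightarrow> bool" where
  iff_refl: "irl_axiom (\<phi> \<^bold>\<leftrightarrow> \<phi>)"
| conj_comm: "irl_axiom (\<phi> \<^bold>\<and> \<psi> \<^bold>\<leftrightarrow> \<psi> \<^bold>\<and> \<phi>)"
| disj_comm: "irl_axiom (\<phi> \<^bold>\<or> \<psi> \<^bold>\<leftrightarrow> \<psi> \<^bold>\<or> \<phi>)"
| conj_assoc: "irl_axiom ((\<phi> \<^bold>\<and> \<psi>) \<^bold>\<and> \<chi> \<^bold>\<leftrightarrow> \<phi> \<^bold>\<and> (\<psi> \<^bold>\<and> \<chi>))"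
| disj_assoc: "irl_axiom ((\<phi> \<^bold>\<or> \<psi>) \<^bold>\<or> \<chi> \<^bold>\<leftrightarrow> \<phi> \<^bold>\<or> (\<psi> \<^bold>\<or> \<chi>))"
| conj_disj_distrib: "irl_axiom (\<phi> \<^bold>\<and> (\<psi> \<^bold>\<or> \<chi>) \<^bold>\<leftrightarrow> (\<phi> \<^bold>\<and> \<psi>) \<^bold>\<or> (\<phi> \<^bold>\<and> \<chi>))"
| disj_conj_distrib: "irl_axiom (\<phi> \<^bold>\<or> (\<psi> \<^bold>\<and> \<chi>) \<^bold>\<leftrightarrow> (\<phi> \<^bold>\<or> \<psi>) \<^bold>\<and> (\<phi> \<^bold>\<or> \<chi>))"
| conj_top: "irl_axiom (\<phi> \<^bold>\<and> \<^bold>\<top> \<^bold>\<leftrightarrow> \<phi>)"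
| disj_bot: "irl_axiom (\<phi> \<^bold>\<or> \<^bold>\<bottom> \<^bold>\<leftrightarrow> \<phi>)"
| conj_neg: "irl_axiom (\<phi> \<^bold>\<and> \<^bold>\<not> \<phi> \<^bold>\<leftrightarrow> \<^bold>\<bottom>)"
| disj_neg: "irl_axiom (\<phi> \<^bold>\<or> \<^bold>\<not> \<phi> \<^bold>\<leftrightarrow> \<^bold>\<top>)"
| imp_def: "irl_axiom ((\<phi> \<^bold>\<rightarrow> \<psi>) \<^bold>\<leftrightarrow> (\<phi> \<^bold>\<and> \<psi> \<^bold>\<leftrightarrow> \<phi>))"

text \<open>
  \<open>replaces \<phi> \<psi> n \<chi> \<chi>'\<close>: the formula \<open>\<chi>'\<close> results from \<open>\<chi>\<close> by replacing \<open>n\<close> selected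
  occurrences of the subformula \<open>\<phi>\<close> by \<open>\<psi>\<close>. Distinct occurrences of \<open>\<phi>\<close> never overlap,
  so the replacements are simultaneous and independent.
\<close>

inductive replaces :: "'k fm \<Rightarrow> 'k fm \<Rightarrow> nat \<Rightarrow> 'k fm \<Rightarrow> 'k fm \<Rightarrow> bool"
  for \<phi> \<psi> :: "'k fm" where
  keep: "replaces \<phi> \<psi> 0 \<chi> \<chi>"
| here: "replaces \<phi> \<psi> 1 \<phi> \<psi>"
| in_neg: "replaces \<phi> \<psi> n \<chi> \<chi>' \<Longrightarrow> replaces \<phi> \<psi> n (\<^bold>\<not> \<chi>) (\<^bold>\<not> \<chi>')"
| in_conj: "\<lbrakk>replaces \<phi> \<psi> m \<chi> \<chi>'; replaces \<phi> \<psi> n \<xi> \<xi>'\<rbrakk>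
    \<Longrightarrow> replaces \<phi> \<psi> (m + n) (\<chi> \<^bold>\<and> \<xi>) (\<chi>' \<^bold>\<and> \<xi>')"
| in_disj: "\<lbrakk>replaces \<phi> \<psi> m \<chi> \<chi>'; replaces \<phi> \<psi> n \<xi> \<xi>'\<rbrakk>
    \<Longrightarrow> replaces \<phi> \<psi> (m + n) (\<chi> \<^bold>\<or> \<xi>) (\<chi>' \<^bold>\<or> \<xi>')"
| in_imp: "\<lbrakk>replaces \<phi> \<psi> m \<chi> \<chi>'; replaces \<phi> \<psi> n \<xi> \<xi>'\<rbrakk>
    \<Longrightarrow> replaces \<phi> \<psi> (m + n) (\<chi> \<^bold>\<rightarrow> \<xi>) (\<chi>' \<^bold>\<rightarrow> \<xi>')"
| in_iff: "\<lbrakk>replaces \<phi> \<psi> m \<chi> \<chi>'; replaces \<phi> \<psi> n \<xi> \<xi>'\<rbrakk>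
    \<Longrightarrow> replaces \<phi> \<psi> (m + n) (\<chi> \<^bold>\<leftrightarrow> \<xi>) (\<chi>' \<^bold>\<leftrightarrow> \<xi>')"

inductive by_rule :: "'k fm set \<Rightarrow> 'k fm \<Rightarrow> bool"
  for A :: "'k fm set" where
  R1: "\<lbrakk>\<phi> \<in> A; \<psi> \<in> A\<rbrakk> \<Longrightarrow> by_rule A (\<phi> \<^bold>\<and> \<psi>)"
| R2: "\<phi> \<^bold>\<and> \<psi> \<in> A \<Longrightarrow> by_rule A \<phi>"
| R3: "\<lbrakk>\<phi> \<^bold>\<leftrightarrow> \<psi> \<in> A; \<chi> \<in> A; replaces \<phi> \<psi> n \<chi> \<chi>'; n \<ge> 1\<rbrakk> \<Longrightarrow> by_rule A \<chi>'"

text \<open>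
  Theorems and derivation sequences depend on each other: theorems may be cited in a
  derivation, and conditional proof turns a derivation into a theorem. The premises \<open>X\<close>
  are available to the rules at every step but are not themselves steps.
\<close>

inductive irl_theorem :: "'k fm \<Rightarrow> bool"
  and derivation :: "'k fm set \<Rightarrow> 'k fm list \<Rightarrow> bool" where
  thm_axiom: "irl_axiom \<phi> \<Longrightarrow> irl_theorem \<phi>"
| thm_derivation: "derivation {} (ys @ [\<phi>]) \<Longrightarrow> irl_theorem \<phi>"
| R4: "derivation {\<phi>} (ys @ [\<psi>]) \<Longrightarrow> irl_theorem (\<phi> \<^bold>\<rightarrow> \<psi>)"
| start: "finite X \<Longrightarrow> derivation X []"
| step_theorem: "\<lbrakk>derivation X ys; irl_theorem y\<rbrakk> \<Longrightarrow> derivation X (ys @ [y])"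
| step_rule: "\<lbrakk>derivation X ys; by_rule (X \<union> set ys) y\<rbrakk> \<Longrightarrow> derivation X (ys @ [y])"

definition derives :: "'k fm set \<Rightarrow> 'k fm \<Rightarrow> bool"  (infix "\<turnstile>" 50) where
  "X \<turnstile> y \<longleftrightarrow> (\<exists>ys. derivation X (ys @ [y]))"

lemma irl_theorem_iff_derives: "irl_theorem y \<longleftrightarrow> {} \<turnstile> y"
  unfolding derives_def
  by (metis finite.emptyI start step_theorem thm_derivation)

lemma conditional_proof: "{\<phi>} \<turnstile> \<psi> \<Longrightarrow> {} \<turnstile> \<phi> \<^bold>\<rightarrow> \<psi>"
  using R4 irl_theorem_iff_derives unfolding derives_def by metis

end

theory Submission
  imports Defs
begin

text \<open>
  Provable equivalence is a congruence, so the axioms make the formulas modulo equivalence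
  a Boolean algebra. There a complement is unique, and both \<open>\<phi>\<close> and \<open>\<^bold>\<not> \<^bold>\<not> \<phi>\<close> are
  complements of \<open>\<^bold>\<not> \<phi>\<close>. Absorption is not needed for uniqueness: if \<open>x \<^bold>\<and> y\<close> is \<open>\<^bold>\<bottom>\<close>
  and \<open>x \<^bold>\<or> z\<close> is \<open>\<^bold>\<top>\<close>, then distributing \<open>y \<^bold>\<and> (x \<^bold>\<or> z)\<close> turns \<open>y\<close> into \<open>y \<^bold>\<and> z\<close>.
\<close>

text \<open>Theorems may be cited as steps, so the two given ones form a derivation from
  \<open>{}\<close>, which \<open>R3\<close> extends by \<open>\<chi>'\<close>.\<close>

lemma irl_theorem_replaces:
  assumes "irl_theorem (\<phi> \<^bold>\<leftrightarrow> \<psi>)" "irl_theorem \<chi>" "replaces \<phi> \<psi> n \<chi> \<chi>'" "n \<ge> 1"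
  shows "irl_theorem \<chi>'"
proof -
  have "derivation {} ([\<phi> \<^bold>\<leftrightarrow> \<psi>] @ [\<chi>])"
    using step_theorem[OF step_theorem[OF start]] assms(1,2) by fastforce
  moreover have "by_rule ({} \<union> set ([\<phi> \<^bold>\<leftrightarrow> \<psi>] @ [\<chi>])) \<chi>'"
    using assms(3,4) by (intro by_rule.R3[of \<phi> \<psi> _ \<chi> n]) auto
  ultimately show ?thesis
    by (blast intro: step_rule thm_derivation)
qed

definition equivalent :: "'k fm \<Rightarrow> 'k fm \<Rightarrow> bool"  (infix "\<approx>" 50) where
  "\<phi> \<approx> \<psi> \<longleftrightarrow> irl_theorem (\<phi> \<^bold>\<leftrightarrow> \<psi>)"

lemma axiom_equivalent: "irl_axiom (\<phi> \<^bold>\<leftrightarrow> \<psi>) \<Longrightarrow> \<phi> \<approx> \<psi>"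
  by (simp add: equivalent_def thm_axiom)

lemma equivalent_sym: "\<psi> \<approx> \<phi>" if "\<phi> \<approx> \<psi>"
  using irl_theorem_replaces[OF _ thm_axiom[OF iff_refl] in_iff[OF here keep]] that
  by (simp add: equivalent_def)

lemma equivalent_trans [trans]: "\<phi> \<approx> \<chi>" if "\<phi> \<approx> \<psi>" "\<psi> \<approx> \<chi>"
  using irl_theorem_replaces[OF _ _ in_iff[OF keep here]] that
  by (simp add: equivalent_def)

lemma conj_cong_right: "\<chi> \<^bold>\<and> \<phi> \<approx> \<chi> \<^bold>\<and> \<psi>" if "\<phi> \<approx> \<psi>"
  using irl_theorem_replaces[OF _ thm_axiom[OF iff_refl] in_iff[OF keep in_conj[OF keep here]]] that
  by (simp add: equivalent_def)

lemma disj_cong_left: "\<phi> \<^bold>\<or> \<chi> \<approx> \<psi> \<^bold>\<or> \<chi>" if "\<phi> \<approx> \<psi>"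
  using irl_theorem_replaces[OF _ thm_axiom[OF iff_refl] in_iff[OF keep in_disj[OF here keep]]] that
  by (simp add: equivalent_def)

lemma equivalent_conj:
  assumes "x \<^bold>\<and> y \<approx> \<^bold>\<bottom>" "x \<^bold>\<or> z \<approx> \<^bold>\<top>"
  shows "y \<approx> y \<^bold>\<and> z"
proof -
  have "y \<approx> y \<^bold>\<and> \<^bold>\<top>"
    by (rule equivalent_sym[OF axiom_equivalent[OF conj_top]])
  also have "y \<^bold>\<and> \<^bold>\<top> \<approx> y \<^bold>\<and> (x \<^bold>\<or> z)"
    by (rule conj_cong_right[OF equivalent_sym[OF assms(2)]])
  also have "y \<^bold>\<and> (x \<^bold>\<or> z) \<approx> (y \<^bold>\<and> x) \<^bold>\<or> (y \<^bold>\<and> z)"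
    by (intro axiom_equivalent conj_disj_distrib)
  also have "(y \<^bold>\<and> x) \<^bold>\<or> (y \<^bold>\<and> z) \<approx> \<^bold>\<bottom> \<^bold>\<or> (y \<^bold>\<and> z)"
    by (rule disj_cong_left[OF equivalent_trans[OF axiom_equivalent[OF conj_comm] assms(1)]])
  also have "\<^bold>\<bottom> \<^bold>\<or> (y \<^bold>\<and> z) \<approx> (y \<^bold>\<and> z) \<^bold>\<or> \<^bold>\<bottom>"
    by (intro axiom_equivalent disj_comm)
  also have "(y \<^bold>\<and> z) \<^bold>\<or> \<^bold>\<bottom> \<approx> y \<^bold>\<and> z"
    by (intro axiom_equivalent disj_bot)
  finally show ?thesis .
qed

lemma complement_unique:
  assumes "x \<^bold>\<and> y \<approx> \<^bold>\<bottom>" "x \<^bold>\<or> y \<approx> \<^bold>\<top>" "x \<^bold>\<and> z \<approx> \<^bold>\<bottom>" "x \<^bold>\<or> z \<approx> \<^bold>\<top>"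
  shows "y \<approx> z"
proof -
  have "y \<approx> y \<^bold>\<and> z"
    using assms(1,4) by (rule equivalent_conj)
  also have "y \<^bold>\<and> z \<approx> z \<^bold>\<and> y"
    by (intro axiom_equivalent conj_comm)
  \<comment> \<open>The same argument with \<open>y\<close> and \<open>z\<close> exchanged, using
    the other two hypotheses.\<close>
  also have "z \<^bold>\<and> y \<approx> z"
    by (rule equivalent_sym[OF equivalent_conj[OF assms(3,2)]])
  finally show ?thesis .
qed

theorem theorem3p4p2:
  fixes \<phi> :: "('k::countable) fm"
  shows "irl_theorem (\<^bold>\<not> \<^bold>\<not> \<phi> \<^bold>\<leftrightarrow> \<phi>)"
proof -
  have "\<^bold>\<not> \<^bold>\<not> \<phi> \<approx> \<phi>"
  proof (rule complement_unique)
    show "\<^bold>\<not> \<phi> \<^bold>\<and> \<^bold>\<not> \<^bold>\<not> \<phi> \<approx> \<^bold>\<bottom>"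
      by (intro axiom_equivalent conj_neg)
    show "\<^bold>\<not> \<phi> \<^bold>\<or> \<^bold>\<not> \<^bold>\<not> \<phi> \<approx> \<^bold>\<top>"
      by (intro axiom_equivalent disj_neg)
    \<comment> \<open>The complement axioms have the negation on the right, so here and in the last
      case the operands are swapped first.\<close>
    show "\<^bold>\<not> \<phi> \<^bold>\<and> \<phi> \<approx> \<^bold>\<bottom>"
      by (rule equivalent_trans[OF axiom_equivalent[OF conj_comm] axiom_equivalent[OF conj_neg]])
    show "\<^bold>\<not> \<phi> \<^bold>\<or> \<phi> \<approx> \<^bold>\<top>"
      by (rule equivalent_trans[OF axiom_equivalent[OF disj_comm] axiom_equivalent[OF disj_neg]])
  qed
  then show ?thesis
    by (simp add: equivalent_def)
qed

end
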